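(* There exists a non-soluble ordered group $G$ such that for every integer $k\ge 3$ there exists a subset $S$ of $G$ with $|S|=k$, $|S^2|=4|S|-5$ and $\langle S\rangle=G$. In particular $\langle S\rangle$ is non-soluble.
   Context: An ordered group is a group $G$ with a total order $\le$ such that $a\le b$ implies $xay\le xby$ for all $a,b,x,y\in G$. For a subset $S$, $S^2=\{x_1x_2 : x_1,x_2\in S\}$, and $\langle S\rangle$ is the subgroup generated by $S$. *)

theory Defs
  imports "HOL-Algebra.Algebra"
begin

text \<open>
  The order \<open>r\<close> is a relation on the carrier: \<open>(a, b) \<in> r\<close> means \<open>a \<le> b\<close>. Note that
  \<^const>\<open>linear_order_on\<close> includes \<open>r \<subseteq> carrier G \<times> carrier G\<close> and reflexivity.
\<close>

locale ordered_group = group G for G (structure) +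
  fixes r :: "('a \<times> 'a) set"
  assumes linear_order: "linear_order_on (carrier G) r"
    and mult_mono: "\<lbrakk> x \<in> carrier G; y \<in> carrier G; a \<in> carrier G; b \<in> carrier G; (a, b) \<in> r \<rbrakk>
      \<Longrightarrow> (x \<otimes> a \<otimes> y, x \<otimes> b \<otimes> y) \<in> r"

end

theory Submission
  imports Defs "HOL-Library.List_Lenlexorder" "HOL-Library.Countable_Set"
begin

text \<open>
  If \<open>b\<close> and \<open>c\<close> satisfy no short relation, then \<open>S = {1, c, \<dots>, c^m, b}\<close> has \<open>m + 2\<close> elements, and
  its square consists of \<open>c^0, \<dots>, c^(2m)\<close>, of \<open>b c^i\<close> and \<open>c^i b\<close> for \<open>i \<le> m\<close> (which coincide for
  \<open>i = 0\<close> only), and of \<open>b^2\<close>; this makes \<open>4m + 3 = 4|S| - 5\<close> elements.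

  Following Magnus, take \<open>b = 1 + Y\<close> and \<open>c = 1 + X\<close> among the formal power series in noncommuting
  variables. Order the words by length and then lexicographically. Leading words multiply under the
  product of series, so the sign of the leading coefficient of \<open>g - f\<close> is a bi-invariant order.
  If the leading words \<open>u\<close> of \<open>f - 1\<close> and \<open>v\<close> of \<open>g - 1\<close> do not commute, then the leading word of
  \<open>[f, g] - 1\<close> is \<open>uv\<close> or \<open>vu\<close>. Hence a pair of elements with noncommuting leading words yields
  such a pair in the derived subgroup, and the group generated by \<open>b\<close> and \<open>c\<close> is not solvable.
\<close>

section \<open>Power series in noncommuting variables\<close>

text \<open>Cauchy product of noncommutative series: a word has only finitely many cuts into prefix
  and suffix, so no condition on the supports is required.\<close>

definition word_conv :: "('a list \<Rightarrow> 'b::ring_1) \<Rightarrow> ('a list \<Rightarrow> 'b) \<Rightarrow> 'a list \<Rightarrow> 'b" where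
  "word_conv f g w = (\<Sum>i\<le>length w. f (take i w) * g (drop i w))"

lemma word_conv_Nil [simp]: "word_conv f g [] = f [] * g []"
  by (simp add: word_conv_def)

text \<open>The empty prefix is split off; every other prefix starts with \<open>x\<close>, which
  turns \<open>f\<close> into its left quotient by \<open>x\<close>. This recursion supports
  induction on the word with the left factor generalised.\<close>

lemma word_conv_Cons [simp]:
  "word_conv f g (x # w) = f [] * g (x # w) + word_conv (\<lambda>v. f (x # v)) g w"
  by (simp add: word_conv_def sum.atMost_Suc_shift del: sum.atMost_Suc)

lemma word_conv_add_left: "word_conv (\<lambda>w. f w + g w) h w = word_conv f h w + word_conv g h w"
  by (simp add: word_conv_def distrib_right sum.distrib)

lemma word_conv_add_right: "word_conv f (\<lambda>w. g w + h w) w = word_conv f g w + word_conv f h w"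
  by (simp add: word_conv_def distrib_left sum.distrib)

lemma word_conv_scale_left: "word_conv (\<lambda>w. a * f w) g w = a * word_conv f g w"
  by (simp add: word_conv_def sum_distrib_left mult.assoc)

lemma word_conv_zero_left [simp]: "word_conv (\<lambda>w. 0) f w = 0"
  by (simp add: word_conv_def)

lemma word_conv_one_left [simp]: "word_conv (\<lambda>w. if w = [] then 1 else 0) f w = f w"
  by (cases w) simp_all

lemma word_conv_one_right [simp]: "word_conv f (\<lambda>w. if w = [] then 1 else 0) w = f w"
  by (induction w arbitrary: f) simp_all

text \<open>By the recursion, the left quotient of \<open>word_conv f g\<close> by \<open>x\<close>
  is a scalar multiple of the left quotient of \<open>g\<close> plus the convolution of the left
  quotient of \<open>f\<close> with \<open>g\<close>. Bilinearity and the induction hypothesis for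
  the quotient of \<open>f\<close> then close the step.\<close>

lemma word_conv_assoc: "word_conv (word_conv f g) h w = word_conv f (word_conv g h) w"
proof (induction w arbitrary: f)
  case (Cons x w)
  then show ?case
    by (simp add: word_conv_add_left word_conv_scale_left algebra_simps)
qed (simp add: mult.assoc)

typedef ('a, 'b) ncseries = "UNIV :: ('a list \<Rightarrow> 'b) set"
  morphisms nc_coeff NCSeries ..

setup_lifting type_definition_ncseries

lemma ncseries_eqI: "(\<And>w. nc_coeff f w = nc_coeff g w) \<Longrightarrow> f = g"
  by transfer blast

instantiation ncseries :: (type, ring_1) ring_1
begin

lift_definition zero_ncseries :: "('a, 'b) ncseries" is "\<lambda>w. 0" .

lift_definition one_ncseries :: "('a, 'b) ncseries" is "\<lambda>w. if w = [] then 1 else 0" .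

lift_definition plus_ncseries :: "('a, 'b) ncseries \<Rightarrow> ('a, 'b) ncseries \<Rightarrow> ('a, 'b) ncseries"
  is "\<lambda>f g w. f w + g w" .

lift_definition minus_ncseries :: "('a, 'b) ncseries \<Rightarrow> ('a, 'b) ncseries \<Rightarrow> ('a, 'b) ncseries"
  is "\<lambda>f g w. f w - g w" .

lift_definition uminus_ncseries :: "('a, 'b) ncseries \<Rightarrow> ('a, 'b) ncseries"
  is "\<lambda>f w. - f w" .

lift_definition times_ncseries :: "('a, 'b) ncseries \<Rightarrow> ('a, 'b) ncseries \<Rightarrow> ('a, 'b) ncseries"
  is word_conv .

instance
  by (standard; transfer)
     (auto simp: fun_eq_iff word_conv_assoc word_conv_add_left word_conv_add_right)

end

lemma nc_coeff_zero [simp]: "nc_coeff 0 w = 0"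
  and nc_coeff_one: "nc_coeff 1 w = (if w = [] then 1 else 0)"
  and nc_coeff_add [simp]: "nc_coeff (f + g) w = nc_coeff f w + nc_coeff g w"
  and nc_coeff_diff [simp]: "nc_coeff (f - g) w = nc_coeff f w - nc_coeff g w"
  and nc_coeff_uminus [simp]: "nc_coeff (- f) w = - nc_coeff f w"
  and nc_coeff_mult: "nc_coeff (f * g) w = word_conv (nc_coeff f) (nc_coeff g) w"
  by (transfer; simp)+

lemma nc_coeff_one_Nil [simp]: "nc_coeff 1 [] = 1"
  and nc_coeff_mult_Nil [simp]: "nc_coeff (f * g) [] = nc_coeff f [] * nc_coeff g []"
  by (simp_all add: nc_coeff_one nc_coeff_mult)

section \<open>Leading words\<close>

text \<open>Concatenation is monotone in both arguments for the length-lexicographic order. For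
  strictness, if \<open>v\<close> and \<open>q\<close> have equal length, equal concatenations would
  be cut at the same place and both parts would agree; otherwise the lengths of the concatenations
  already differ.\<close>

lemma append_less_append:
  fixes u v p q :: "'a::linorder list"
  assumes "u \<le> p" "v \<le> q" "u \<noteq> p \<or> v \<noteq> q"
  shows "u @ v < p @ q"
proof -
  let ?R = "{(x, y). x < (y::'a)}"
  have irr: "irrefl ?R"
    by (simp add: irrefl_def)
  have *: "length x \<le> length y" if "x \<le> y" for x y :: "'a list"
    using that lenlex_length by (auto simp: list_le_def list_less_def)
  show ?thesis
  proof (cases "length v = length q")
    case True
    have "u @ v \<le> p @ v"
      using assms(1) lenlex_append1[OF _ refl, of u p ?R v] by (auto simp: list_le_def list_less_def)
    moreover have "p @ v \<le> p @ q"
      using assms(2) lenlex_append2[OF irr] by (auto simp: list_le_def list_less_def)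
    ultimately have "u @ v \<le> p @ q"
      by order
    moreover have "u @ v \<noteq> p @ q"
      using assms(3) True by auto
    ultimately show ?thesis
      by order
  next
    case False
    then have "length (u @ v) < length (p @ q)"
      using *[OF assms(1)] *[OF assms(2)] by simp
    then show ?thesis
      by (simp add: list_less_def lenlex_conv)
  qed
qed

text \<open>The least word of the support. A well-order on the letters makes the
  length-lexicographic order on words a well-order, so every nonzero series has such a word.\<close>

definition leading_word :: "('a::wellorder, 'b::ring_1) ncseries \<Rightarrow> 'a list \<Rightarrow> bool" where
  "leading_word f w \<longleftrightarrow> nc_coeff f w \<noteq> 0 \<and> (\<forall>v<w. nc_coeff f v = 0)"

lemma leading_word_exists:
  assumes "f \<noteq> 0"
  obtains w where "leading_word f w"
proof -
  have "\<exists>w. nc_coeff f w \<noteq> 0"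
    using assms ncseries_eqI[of f 0] by auto
  then obtain w where "nc_coeff f w \<noteq> 0" "\<forall>v<w. \<not> nc_coeff f v \<noteq> 0"
    using exists_least_iff[of "\<lambda>w. nc_coeff f w \<noteq> 0"] by blast
  then show ?thesis
    using that by (simp add: leading_word_def)
qed

lemma leading_word_nonzero: "leading_word f w \<Longrightarrow> f \<noteq> 0"
  by (auto simp: leading_word_def)

lemma leading_word_Nil: "leading_word f [] \<longleftrightarrow> nc_coeff f [] \<noteq> 0"
  by (simp add: leading_word_def)

lemma leading_word_diff:
  assumes "leading_word f u" "leading_word g v" "u \<noteq> v"
  shows "leading_word (f - g) (min u v)"
  using assms unfolding leading_word_def min_def
  by (cases u v rule: linorder_cases) (auto simp: less_imp_le min_def)

text \<open>If \<open>p @ q \<le> u @ v\<close> is a cut other than \<open>(u, v)\<close>, strict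
  monotonicity of concatenation forces \<open>p < u\<close> or \<open>q < v\<close>, so its term
  vanishes. Hence a single term survives at \<open>u @ v\<close> and none survives below.\<close>

lemma
  fixes f g :: "('a::wellorder, 'b::idom) ncseries"
  assumes f: "leading_word f u" and g: "leading_word g v"
  shows leading_coeff_mult: "nc_coeff (f * g) (u @ v) = nc_coeff f u * nc_coeff g v"
    and leading_word_mult: "leading_word (f * g) (u @ v)"
proof -
  have vanish: "nc_coeff f p * nc_coeff g q = 0"
    if "p @ q \<le> u @ v" "p \<noteq> u \<or> q \<noteq> v" for p q
  proof (rule ccontr)
    assume "nc_coeff f p * nc_coeff g q \<noteq> 0"
    then have "u \<le> p" "v \<le> q"
      using f g by (auto simp: leading_word_def not_less[symmetric])
    then have "u @ v < p @ q"
      using that by (intro append_less_append) auto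
    then show False
      using that by simp
  qed
  have "nc_coeff (f * g) (u @ v) =
      (\<Sum>i\<le>length (u @ v). if i = length u then nc_coeff f u * nc_coeff g v else 0)"
    unfolding nc_coeff_mult word_conv_def
  proof (rule sum.cong[OF refl])
    fix i assume i: "i \<in> {..length (u @ v)}"
    show "nc_coeff f (take i (u @ v)) * nc_coeff g (drop i (u @ v)) =
        (if i = length u then nc_coeff f u * nc_coeff g v else 0)"
    proof (cases "i = length u")
      case False
      then have "take i (u @ v) \<noteq> u"
        using i by (metis atMost_iff length_take min.absorb2)
      then show ?thesis
        using False by (simp only: if_False) (rule vanish, auto simp del: take_append drop_append)
    qed simp
  qed
  then show coeff: "nc_coeff (f * g) (u @ v) = nc_coeff f u * nc_coeff g v"
    by simp
  have "nc_coeff (f * g) w = 0" if "w < u @ v" for w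
    unfolding nc_coeff_mult word_conv_def
  proof (rule sum.neutral, rule ballI, rule vanish)
    fix i
    show "take i w @ drop i w \<le> u @ v"
      using that by simp
    show "take i w \<noteq> u \<or> drop i w \<noteq> v"
      using that by (metis append_take_drop_id less_irrefl)
  qed
  then show "leading_word (f * g) (u @ v)"
    using f g by (simp add: leading_word_def coeff)
qed

instance ncseries :: (wellorder, idom) ring_1_no_zero_divisors
proof
  fix f g :: "('a, 'b) ncseries"
  assume "f \<noteq> 0" "g \<noteq> 0"
  then show "f * g \<noteq> 0"
    by (metis leading_word_exists leading_word_mult leading_word_nonzero)
qed

text \<open>Cancel \<open>f\<close> in \<open>f * (g * f - 1) = 0\<close>. Thus one-sided
  invertibility is enough to define the group below.\<close>

lemma right_inverse_imp_left_inverse: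
  fixes f g :: "'a::ring_1_no_zero_divisors"
  assumes "f * g = 1"
  shows "g * f = 1"
proof -
  have "f * (g * f - 1) = 0"
    using assms by (simp add: right_diff_distrib mult.assoc[symmetric])
  moreover have "f \<noteq> 0"
    using assms by auto
  ultimately show ?thesis
    by simp
qed

section \<open>The positive cone of the ring of series\<close>

definition nc_positive :: "('a::wellorder, 'b::linordered_idom) ncseries \<Rightarrow> bool" where
  "nc_positive f \<longleftrightarrow> (\<exists>w. leading_word f w \<and> nc_coeff f w > 0)"

lemma not_nc_positive_zero [simp]: "\<not> nc_positive 0"
  by (simp add: nc_positive_def leading_word_def)

lemma nc_positive_trichotomy: "f = 0 \<or> nc_positive f \<or> nc_positive (- f)"
proof (cases "f = 0")
  case False
  then obtain w where w: "leading_word f w"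
    by (rule leading_word_exists)
  then have "leading_word (- f) w" "nc_coeff f w \<noteq> 0"
    by (simp_all add: leading_word_def)
  with w show ?thesis
    unfolding nc_positive_def by (metis nc_coeff_uminus neg_0_less_iff_less linorder_neqE_linordered_idom)
qed simp

lemma nc_positive_add:
  assumes "nc_positive f" "nc_positive g"
  shows "nc_positive (f + g)"
proof -
  obtain u v where u: "leading_word f u" "nc_coeff f u > 0" and v: "leading_word g v" "nc_coeff g v > 0"
    using assms by (auto simp: nc_positive_def)
  then have "leading_word (f + g) (min u v) \<and> nc_coeff (f + g) (min u v) > 0"
    unfolding leading_word_def
    by (cases u v rule: linorder_cases) (auto simp: add_pos_pos less_imp_le min_def)
  then show ?thesis
    unfolding nc_positive_def by blast
qed

lemma nc_positive_mult: "nc_positive f \<Longrightarrow> nc_positive g \<Longrightarrow> nc_positive (f * g)"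
  unfolding nc_positive_def
  by (metis leading_word_mult leading_coeff_mult mult_pos_pos)

section \<open>Invertible series with constant term 1\<close>

text \<open>Invertibility is built into the carrier, so an explicit inverse has to be computed only
  for the generators \<open>1 + nc_var x\<close>.\<close>

definition magnus_group :: "('a::wellorder, 'b::linordered_idom) ncseries monoid" where
  "magnus_group = \<lparr>carrier = {f. nc_coeff f [] = 1 \<and> (\<exists>g. f * g = 1)}, monoid.mult = (*), one = 1\<rparr>"

definition magnus_order :: "('a::wellorder, 'b::linordered_idom) ncseries rel" where
  "magnus_order = {(f, g). f \<in> carrier magnus_group \<and> g \<in> carrier magnus_group \<and>
     (f = g \<or> nc_positive (g - f))}"

lemma magnus_group_simps [simp]:
  "monoid.mult magnus_group = (*)" "one magnus_group = 1"
  "f \<in> carrier magnus_group \<longleftrightarrow> nc_coeff f [] = 1 \<and> (\<exists>g. f * g = 1)"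
  by (simp_all add: magnus_group_def)

lemma group_magnus_group: "group magnus_group"
proof (rule groupI)
  fix f g :: "('a, 'b) ncseries"
  assume "f \<in> carrier magnus_group" "g \<in> carrier magnus_group"
  then obtain f' g' where *: "nc_coeff f [] = 1" "nc_coeff g [] = 1" "f * f' = 1" "g * g' = 1"
    by auto
  have "(f * g) * (g' * f') = f * (g * g') * f'"
    by (simp only: mult.assoc)
  then have "(f * g) * (g' * f') = 1"
    using * by simp
  then show "f \<otimes>\<^bsub>magnus_group\<^esub> g \<in> carrier magnus_group"
    using * by auto
next
  fix f :: "('a, 'b) ncseries"
  assume "f \<in> carrier magnus_group"
  then obtain g where g: "nc_coeff f [] = 1" "f * g = 1"
    by auto
  then have "nc_coeff g [] = 1"
    by (metis mult_1 nc_coeff_mult_Nil nc_coeff_one_Nil)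
  then show "\<exists>g\<in>carrier magnus_group. g \<otimes>\<^bsub>magnus_group\<^esub> f = \<one>\<^bsub>magnus_group\<^esub>"
    using g right_inverse_imp_left_inverse by fastforce
qed (auto simp: mult.assoc intro: exI[of _ 1])

lemma magnus_group_nc_positive: "f \<in> carrier magnus_group \<Longrightarrow> nc_positive f"
  unfolding nc_positive_def by (intro exI[of _ "[]"]) (simp add: leading_word_Nil)

text \<open>Bi-invariance rests on \<open>x * g * y - x * f * y = x * (g - f) * y\<close>: elements
  of the group have constant term 1, hence are positive, and positive series are closed under
  products. Sums and trichotomy of positive series give a linear order.\<close>

lemma ordered_group_magnus_group: "ordered_group magnus_group magnus_order"
proof (intro ordered_group.intro ordered_group_axioms.intro group_magnus_group)
  let ?C = "carrier (magnus_group :: ('a, 'b) ncseries monoid)"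
  show "linear_order_on ?C magnus_order"
    unfolding linear_order_on_def partial_order_on_def preorder_on_def
  proof (intro conjI)
    show "(magnus_order :: ('a, 'b) ncseries rel) \<subseteq> ?C \<times> ?C"
      by (auto simp: magnus_order_def simp del: magnus_group_simps)
    show "refl_on ?C magnus_order"
      by (auto simp: magnus_order_def refl_on_def simp del: magnus_group_simps)
    show "trans (magnus_order :: ('a, 'b) ncseries rel)"
    proof (rule transI)
      fix f g h :: "('a, 'b) ncseries"
      assume "(f, g) \<in> magnus_order" "(g, h) \<in> magnus_order"
      then show "(f, h) \<in> magnus_order"
        using nc_positive_add[of "g - f" "h - g"]
        by (auto simp: magnus_order_def simp del: magnus_group_simps)
    qed
    show "antisym (magnus_order :: ('a, 'b) ncseries rel)"
    proof (rule antisymI)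
      fix f g :: "('a, 'b) ncseries"
      assume "(f, g) \<in> magnus_order" "(g, f) \<in> magnus_order"
      then show "f = g"
        using nc_positive_add[of "g - f" "f - g"] by (auto simp: magnus_order_def)
    qed
    show "total_on ?C magnus_order"
    proof (rule total_onI)
      fix f g :: "('a, 'b) ncseries"
      assume "f \<in> ?C" "g \<in> ?C" "f \<noteq> g"
      then show "(f, g) \<in> magnus_order \<or> (g, f) \<in> magnus_order"
        using nc_positive_trichotomy[of "g - f"]
        by (auto simp: magnus_order_def simp del: magnus_group_simps)
    qed
  qed
next
  interpret group magnus_group
    by (rule group_magnus_group)
  fix x y f g :: "('a, 'b) ncseries"
  assume C: "x \<in> carrier magnus_group" "y \<in> carrier magnus_group"
      "f \<in> carrier magnus_group" "g \<in> carrier magnus_group"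
    and "(f, g) \<in> magnus_order"
  then consider "f = g" | "nc_positive (g - f)"
    by (auto simp: magnus_order_def)
  then have "x * f * y = x * g * y \<or> nc_positive (x * g * y - x * f * y)"
  proof cases
    case 2
    then have "nc_positive (x * (g - f) * y)"
      using C 2 by (simp add: nc_positive_mult magnus_group_nc_positive del: magnus_group_simps(3))
    then show ?thesis
      by (simp add: algebra_simps)
  qed simp
  moreover have "x * f * y \<in> carrier magnus_group" "x * g * y \<in> carrier magnus_group"
    using C m_closed[OF m_closed] by (simp_all del: magnus_group_simps(3))
  ultimately show "(x \<otimes>\<^bsub>magnus_group\<^esub> f \<otimes>\<^bsub>magnus_group\<^esub> y, x \<otimes>\<^bsub>magnus_group\<^esub> g \<otimes>\<^bsub>magnus_group\<^esub> y)
      \<in> magnus_order"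
    by (simp add: magnus_order_def del: magnus_group_simps(3))
qed

section \<open>Commutators and non-solvability\<close>

lemma leading_word_commutator:
  fixes a b :: "('a::wellorder, 'b::linordered_idom) ncseries"
  assumes ab: "a \<in> carrier magnus_group" "b \<in> carrier magnus_group"
    and lead: "leading_word (a - 1) u" "leading_word (b - 1) v"
    and uv: "u @ v \<noteq> v @ u"
  shows "leading_word (a \<otimes>\<^bsub>magnus_group\<^esub> b \<otimes>\<^bsub>magnus_group\<^esub> inv\<^bsub>magnus_group\<^esub> a
      \<otimes>\<^bsub>magnus_group\<^esub> inv\<^bsub>magnus_group\<^esub> b - 1) (min (u @ v) (v @ u))"
proof -
  interpret group magnus_group
    by (rule group_magnus_group)
  define a' b' where "a' = inv\<^bsub>magnus_group\<^esub> a" "b' = inv\<^bsub>magnus_group\<^esub> b"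
  have inv: "a * a' = 1" "b * b' = 1" "nc_coeff a' [] = 1" "nc_coeff b' [] = 1"
    using r_inv[OF ab(1)] r_inv[OF ab(2)] inv_closed[OF ab(1)] inv_closed[OF ab(2)]
    by (simp_all add: a'_b'_def)
  \<comment> \<open>Since \<open>b * a * (a' * b') = 1\<close>, the factor \<open>a' * b'\<close>
    can be pulled out of the commutator minus 1. In the remaining \<open>a * b - b * a\<close> the
    constant terms drop out, which exposes the leading words \<open>u @ v\<close> and
    \<open>v @ u\<close>; being different, they cannot cancel. The factor \<open>a' * b'\<close> has
    constant term 1 and does not move the leading word.\<close>
  have "b * a * (a' * b') = b * (a * a') * b'"
    by (simp only: mult.assoc)
  then have "a * b * a' * b' - 1 = (a * b - b * a) * (a' * b')"
    using inv by (simp add: left_diff_distrib mult.assoc)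
  also have "a * b - b * a = (a - 1) * (b - 1) - (b - 1) * (a - 1)"
    by (simp add: algebra_simps)
  finally have eq: "a * b * a' * b' - 1 = ((a - 1) * (b - 1) - (b - 1) * (a - 1)) * (a' * b')" .
  have "leading_word ((a - 1) * (b - 1) - (b - 1) * (a - 1)) (min (u @ v) (v @ u))"
    using lead uv by (intro leading_word_diff leading_word_mult)
  moreover have "leading_word (a' * b') []"
    using inv by (simp add: leading_word_Nil)
  ultimately have "leading_word (a * b * a' * b' - 1) (min (u @ v) (v @ u) @ [])"
    unfolding eq by (rule leading_word_mult)
  then show ?thesis
    by (simp add: a'_b'_def)
qed

text \<open>An invariant that passes to derived subgroups and fails for the trivial group.\<close>

definition noncommuting_leads :: "('a::wellorder, 'b::linordered_idom) ncseries set \<Rightarrow> bool" where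
  "noncommuting_leads H \<longleftrightarrow> (\<exists>a\<in>H. \<exists>b\<in>H. \<exists>u v.
     leading_word (a - 1) u \<and> leading_word (b - 1) v \<and> u @ v \<noteq> v @ u)"

text \<open>The witnesses in the derived subgroup are \<open>[a, b]\<close> and
  \<open>[a, [a, b]]\<close>. Their leading words are \<open>w\<close>, the smaller of
  \<open>u @ v\<close> and \<open>v @ u\<close>, and the smaller of \<open>u @ w\<close> and
  \<open>w @ u\<close>.\<close>

lemma noncommuting_leads_derived:
  fixes H :: "('a::wellorder, 'b::linordered_idom) ncseries set"
  assumes H: "subgroup H magnus_group" and "noncommuting_leads H"
  shows "noncommuting_leads (derived magnus_group H)"
proof -
  interpret H: subgroup H magnus_group
    by (rule H)
  interpret group magnus_group
    by (rule group_magnus_group)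
  define comm where "comm a b = a \<otimes>\<^bsub>magnus_group\<^esub> b \<otimes>\<^bsub>magnus_group\<^esub> inv\<^bsub>magnus_group\<^esub> a
      \<otimes>\<^bsub>magnus_group\<^esub> inv\<^bsub>magnus_group\<^esub> b" for a b :: "('a, 'b) ncseries"
  have comm_derived: "comm a b \<in> derived magnus_group H" if "a \<in> H" "b \<in> H" for a b
    using that unfolding derived_def comm_def by (auto intro!: generate.incl)
  have comm_H: "comm a b \<in> H" if "a \<in> H" "b \<in> H" for a b
    using that unfolding comm_def by blast
  have comm_lead: "leading_word (comm a b - 1) (min (u @ v) (v @ u))"
    if "a \<in> H" "b \<in> H" "leading_word (a - 1) u" "leading_word (b - 1) v" "u @ v \<noteq> v @ u" for a b u v
    using that H.mem_carrier unfolding comm_def by (intro leading_word_commutator) blast+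
  \<comment> \<open>Whichever product is the minimum, commuting with \<open>p\<close> would give
    \<open>p @ q = q @ p\<close> after cancelling \<open>p\<close> on the left or on the
    right.\<close>
  have words: "p @ min (p @ q) (q @ p) \<noteq> min (p @ q) (q @ p) @ p" if "p @ q \<noteq> q @ p" for p q :: "'a list"
    using that by (simp add: min_def)
  obtain a b u v where ab: "a \<in> H" "b \<in> H" "leading_word (a - 1) u" "leading_word (b - 1) v" "u @ v \<noteq> v @ u"
    using assms(2) by (auto simp: noncommuting_leads_def)
  let ?w = "min (u @ v) (v @ u)"
  have w: "leading_word (comm a b - 1) ?w" "u @ ?w \<noteq> ?w @ u"
    using ab by (simp_all add: comm_lead words)
  have w': "leading_word (comm a (comm a b) - 1) (min (u @ ?w) (?w @ u))"
    using ab w comm_H by (intro comm_lead) simp_all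
  \<comment> \<open>The same fact with \<open>?w\<close> in the role of \<open>p\<close> and
    \<open>u\<close> in the role of \<open>q\<close>.\<close>
  have "?w @ min (?w @ u) (u @ ?w) \<noteq> min (?w @ u) (u @ ?w) @ ?w"
    using w(2) by (intro words) metis
  then have "?w @ min (u @ ?w) (?w @ u) \<noteq> min (u @ ?w) (?w @ u) @ ?w"
    by (simp only: min.commute[of "u @ ?w"] not_False_eq_True)
  then show ?thesis
    unfolding noncommuting_leads_def
    using w(1) w' ab comm_H comm_derived by blast
qed

lemma noncommuting_leads_imp_not_solvable:
  assumes H: "subgroup H magnus_group" and "noncommuting_leads H"
  shows "\<not> solvable (magnus_group\<lparr>carrier := H\<rparr>)"
proof
  interpret group magnus_group
    by (rule group_magnus_group)
  interpret K: group "magnus_group\<lparr>carrier := H\<rparr>"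
    by (rule subgroup_imp_group[OF H])
  \<comment> \<open>Solvability of \<open>H\<close> refers to \<open>H\<close> as a group of its
    own; the inclusion moves it into \<open>magnus_group\<close>, where the derived series is
    computed.\<close>
  interpret incl: group_hom "magnus_group\<lparr>carrier := H\<rparr>" magnus_group id
    using subgroup.subset[OF H] by unfold_locales (auto simp: hom_def)
  have leads: "noncommuting_leads ((derived magnus_group ^^ n) H)" for n
  proof (induction n)
    case (Suc n)
    then show ?case
      using noncommuting_leads_derived[OF exp_of_derived_is_subgroup[OF H]] by simp
  qed (simp add: assms(2))
  assume "solvable (magnus_group\<lparr>carrier := H\<rparr>)"
  then have "solvable_seq magnus_group H"
    using incl.solvable_imp_solvable_img[of H] by (simp add: solvable_def)
  then obtain n where "(derived magnus_group ^^ n) H = {1}"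
    using solvable_imp_trivial_derived_seq by auto
  \<comment> \<open>In the trivial group \<open>a - 1 = 0\<close>, which has no leading
    word.\<close>
  then show False
    using leads[of n] by (auto simp: noncommuting_leads_def leading_word_def)
qed

section \<open>Magnus generators\<close>

lift_definition nc_var :: "'a \<Rightarrow> ('a, 'b::ring_1) ncseries"
  is "\<lambda>x w. if w = [x] then 1 else 0" .

lemma nc_coeff_var: "nc_coeff (nc_var x) w = (if w = [x] then 1 else 0)"
  by transfer simp

lemma one_plus_nc_var_in_magnus_group: "1 + nc_var x \<in> carrier magnus_group"
proof -
  \<comment> \<open>The geometric series of \<open>- nc_var x\<close>: the words over the single
    letter \<open>x\<close> are its powers.\<close>
  define g :: "('a, 'b) ncseries"
    where "g = NCSeries (\<lambda>w. if set w \<subseteq> {x} then (- 1) ^ length w else 0)"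
  have g: "nc_coeff g w = (if set w \<subseteq> {x} then (- 1) ^ length w else 0)" for w
    by (simp add: g_def NCSeries_inverse)
  have "nc_coeff ((1 + nc_var x) * g) w = nc_coeff 1 w" for w
  proof (cases w)
    case (Cons y v)
    then show ?thesis
      by (cases "y = x") (simp_all add: distrib_right nc_coeff_one nc_coeff_mult nc_coeff_var g)
  qed (simp add: nc_coeff_var g)
  then have "(1 + nc_var x) * g = 1"
    by (rule ncseries_eqI)
  then show ?thesis
    by (auto simp: nc_coeff_var)
qed

lemma leading_word_nc_var: "leading_word (nc_var x) [x]"
  by (auto simp: leading_word_def nc_coeff_var)

lemma nc_coeff_mult_singleton:
  "nc_coeff (f * g) [x] = nc_coeff f [] * nc_coeff g [x] + nc_coeff f [x] * nc_coeff g []"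
  by (simp add: nc_coeff_mult)

lemma nc_coeff_mult_pair:
  "nc_coeff (f * g) [x, y] =
    nc_coeff f [] * nc_coeff g [x, y] + nc_coeff f [x] * nc_coeff g [y] + nc_coeff f [x, y] * nc_coeff g []"
  by (simp add: nc_coeff_mult)

lemma nc_coeff_power_Nil [simp]: "nc_coeff (f ^ n) [] = nc_coeff f [] ^ n"
  by (induction n) simp_all

text \<open>A power of \<open>1 + X\<close> involves no letter but \<open>x\<close>, and its linear
  coefficient is the exponent. These three coefficients serve to exclude all the short
  relations.\<close>

lemma nc_coeff_one_plus_var_power:
  fixes x y :: 'a
  assumes "x \<noteq> y"
  shows "nc_coeff ((1 + nc_var x :: ('a, 'b::ring_1) ncseries) ^ n) [x] = of_nat n"
    and "nc_coeff ((1 + nc_var x :: ('a, 'b::ring_1) ncseries) ^ n) [y] = 0"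
    and "nc_coeff ((1 + nc_var x :: ('a, 'b::ring_1) ncseries) ^ n) [x, y] = 0"
  using assms
  by (induction n) (simp_all add: nc_coeff_mult_singleton nc_coeff_mult_pair nc_coeff_one nc_coeff_var)

lemma nat_pow_magnus_group: "f [^]\<^bsub>magnus_group\<^esub> n = f ^ (n::nat)"
  by (induction n) (simp_all add: nat_pow_def power_commutes)

section \<open>Squares of progressions with one extra element\<close>

text \<open>The hypotheses are exactly the non-relations that keep the pieces of the square apart.
  The conclusion \<open>j = 0\<close> in \<open>comm\<close> leaves room for the one unavoidable
  coincidence, \<open>b\<close> itself.\<close>

lemma (in group) small_doubling_set:
  assumes b: "b \<in> carrier G" and c: "c \<in> carrier G"
    and inj: "\<And>(i::nat) (j::nat). c [^] i = c [^] j \<Longrightarrow> i = j"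
    and comm: "\<And>(i::nat) (j::nat). b \<otimes> c [^] i = c [^] j \<otimes> b \<Longrightarrow> j = 0"
    and left: "\<And>(i::nat) (j::nat). b \<otimes> c [^] i \<noteq> c [^] j"
    and right: "\<And>(i::nat) (j::nat). c [^] i \<otimes> b \<noteq> c [^] j"
    and square: "\<And>i::nat. b \<otimes> b \<noteq> c [^] i"
    and k: "3 \<le> k"
  obtains S where "S \<subseteq> generate G {b, c}" "{b, c} \<subseteq> S" "card S = k"
    "card (S <#> S) = 4 * card S - 5"
proof -
  \<comment> \<open>The \<open>m + 1\<close> powers of \<open>c\<close> together with
    \<open>b\<close> make \<open>k\<close> elements; \<open>k \<ge> 3\<close> gives
    \<open>m \<ge> 1\<close>, so that \<open>c\<close> itself is among them.\<close>
  define m where "m = k - 2"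
  have m: "k = m + 2" "1 \<le> m"
    using k by (simp_all add: m_def)
  let ?T = "(\<lambda>i. c [^] i) ` {..m}"
  define S where "S = insert b ?T"
  have b_notin: "b \<noteq> c [^] i" for i :: nat
    using left[of 0 i] b by simp
  have inj_pow: "inj_on (\<lambda>i::nat. c [^] i) A" for A
    by (rule inj_onI) (rule inj)
  have "card S = k"
    using b_notin by (simp add: S_def m card_insert_if image_iff card_image[OF inj_pow])
  moreover have "{b, c} \<subseteq> S"
    using m c by (auto simp: S_def intro!: image_eqI[of _ _ 1])
  moreover have "S \<subseteq> generate G {b, c}"
  proof -
    have "subgroup (generate G {b, c}) G"
      using b c by (intro generate_is_subgroup) auto
    then have "c [^] (i::nat) \<in> generate G {b, c}" for i
      using generate.incl[of c "{b, c}" G]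
      by (induction i) (auto simp: subgroup.one_closed subgroup.m_closed)
    then show ?thesis
      by (auto simp: S_def generate.incl)
  qed
  moreover have "card (S <#> S) = 4 * card S - 5"
  proof -
    \<comment> \<open>\<open>?R\<close> starts at exponent 1, because
      \<open>c [^] 0 \<otimes> b = b\<close> already lies in \<open>?L\<close>.\<close>
    let ?P = "(\<lambda>i. c [^] i) ` {..2 * m}" and ?L = "(\<lambda>i. b \<otimes> c [^] i) ` {..m}"
      and ?R = "(\<lambda>i. c [^] i \<otimes> b) ` {1..m}"
    have TT: "?T <#> ?T = ?P"
    proof
      have "c [^] i \<otimes> c [^] j \<in> ?P" if "i \<le> m" "j \<le> m" for i j :: nat
        using that c by (intro image_eqI[of _ _ "i + j"]) (simp_all add: nat_pow_mult)
      then show "?T <#> ?T \<subseteq> ?P"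
        unfolding set_mult_def by blast
      have "c [^] i \<in> ?T <#> ?T" if "i \<le> 2 * m" for i
      proof -
        have "c [^] i = c [^] min i m \<otimes> c [^] (i - min i m)"
          using c by (simp add: nat_pow_mult)
        moreover have "min i m \<in> {..m}" "i - min i m \<in> {..m}"
          using that by auto
        ultimately show ?thesis
          unfolding set_mult_def by blast
      qed
      then show "?P \<subseteq> ?T <#> ?T"
        by blast
    qed
    have b_L: "b \<in> ?L"
      by (rule image_eqI[of _ _ 0]) (simp_all add: b)
    have "{..m} = insert 0 {1..m}"
      by auto
    then have R: "(\<lambda>i. c [^] i \<otimes> b) ` {..m} = insert b ?R"
      using b by simp
    have "S <#> S = (?T <#> ?T) \<union> ?L \<union> (\<lambda>i. c [^] i \<otimes> b) ` {..m} \<union> {b \<otimes> b}"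
      unfolding S_def set_mult_def by auto
    then have SS: "S <#> S = ?P \<union> (?L \<union> (?R \<union> {b \<otimes> b}))"
      unfolding TT R using b_L by (simp add: Un_ac insert_absorb)
    have "?R \<inter> {b \<otimes> b} = {}"
      using b c b_notin by (auto dest: r_cancel)
    moreover have "?L \<inter> (?R \<union> {b \<otimes> b}) = {}"
    proof -
      have "b \<otimes> c [^] i \<noteq> c [^] j \<otimes> b" if "j \<in> {1..m}" for i :: nat and j
        using comm[of i j] that by auto
      moreover have "b \<otimes> c [^] i \<noteq> b \<otimes> b" for i :: nat
        using b c b_notin[of i] by auto
      ultimately show ?thesis
        by blast
    qed
    moreover have "?P \<inter> (?L \<union> (?R \<union> {b \<otimes> b})) = {}"
    proof -
      have "?L \<inter> ?P = {}" "?R \<inter> ?P = {}" "{b \<otimes> b} \<inter> ?P = {}"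
        using left right square by blast+
      then show ?thesis
        by blast
    qed
    moreover have "inj_on (\<lambda>i::nat. b \<otimes> c [^] i) A" "inj_on (\<lambda>i::nat. c [^] i \<otimes> b) A" for A
      by (rule inj_onI, rule inj, use b c in simp)+
    then have "card ?L = m + 1" "card ?R = m"
      by (simp_all add: card_image)
    moreover have "card ?P = 2 * m + 1"
      by (simp add: card_image[OF inj_pow])
    \<comment> \<open>The disjoint pieces contribute \<open>(2 * m + 1) + (m + 1) + m + 1\<close>,
      which is \<open>4 * (m + 2) - 5\<close>.\<close>
    ultimately have "card (S <#> S) = 4 * m + 3"
      unfolding SS by (simp add: card_Un_disjoint)
    then show ?thesis
      using \<open>card S = k\<close> m by simp
  qed
  ultimately show ?thesis
    using that by blast
qed

section \<open>Countable ordered groups\<close>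

text \<open>Every generated element is the product of a finite list of generators and inverses, and
  there are countably many such lists.\<close>

lemma (in group) countable_generate:
  assumes "countable S" "S \<subseteq> carrier G"
  shows "countable (generate G S)"
proof -
  let ?L = "lists (S \<union> (\<lambda>x. inv x) ` S)" and ?p = "\<lambda>xs. foldr (\<otimes>) xs \<one>"
  have closed: "?p xs \<in> carrier G" if "xs \<in> ?L" for xs
    using that assms(2) by induction auto
  have append: "?p (xs @ ys) = ?p xs \<otimes> ?p ys" if "xs \<in> ?L" "ys \<in> ?L" for xs ys
    using that(1)
  proof induction
    case (Cons a l)
    then have "a \<in> carrier G" "?p l \<in> carrier G" "?p ys \<in> carrier G"
      using assms(2) closed that(2) by blast+
    then show ?case
      using Cons by (simp add: m_assoc)
  qed (simp add: closed[OF that(2)])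
  have "generate G S \<subseteq> ?p ` ?L"
  proof
    fix x assume "x \<in> generate G S"
    then show "x \<in> ?p ` ?L"
    proof induction
      case one
      show ?case by (rule image_eqI[of _ _ "[]"]) auto
    next
      case (incl h)
      then show ?case using assms(2) by (intro image_eqI[of _ _ "[h]"]) auto
    next
      case (inv h)
      then show ?case using assms(2) by (intro image_eqI[of _ _ "[inv h]"]) auto
    next
      case (eng h1 h2)
      then obtain xs ys where "xs \<in> ?L" "ys \<in> ?L" "h1 = ?p xs" "h2 = ?p ys"
        by auto
      then show ?case using append by (intro image_eqI[of _ _ "xs @ ys"]) auto
    qed
  qed
  moreover have "countable ?L"
    using assms(1) by auto
  ultimately show ?thesis
    by (meson countable_image countable_subset)
qed

lemma (in ordered_group) ordered_subgroup:
  assumes "subgroup H G"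
  shows "ordered_group (G\<lparr>carrier := H\<rparr>) (Restr r H)"
proof (intro ordered_group.intro ordered_group_axioms.intro)
  interpret H: subgroup H G
    by (rule assms)
  show "group (G\<lparr>carrier := H\<rparr>)"
    using assms by (rule subgroup_imp_group)
  show "linear_order_on (carrier (G\<lparr>carrier := H\<rparr>)) (Restr r H)"
    using linear_order H.subset
    by (auto simp: linear_order_on_def partial_order_on_def preorder_on_def refl_on_def
        total_on_def antisym_def intro!: transI dest: transD)
  show "(x \<otimes>\<^bsub>G\<lparr>carrier := H\<rparr>\<^esub> a \<otimes>\<^bsub>G\<lparr>carrier := H\<rparr>\<^esub> y, x \<otimes>\<^bsub>G\<lparr>carrier := H\<rparr>\<^esub> b \<otimes>\<^bsub>G\<lparr>carrier := H\<rparr>\<^esub> y)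
      \<in> Restr r H"
    if "x \<in> carrier (G\<lparr>carrier := H\<rparr>)" "y \<in> carrier (G\<lparr>carrier := H\<rparr>)"
      "a \<in> carrier (G\<lparr>carrier := H\<rparr>)" "b \<in> carrier (G\<lparr>carrier := H\<rparr>)" "(a, b) \<in> Restr r H" for x y a b
    using that mult_mono by auto
qed

text \<open>Transport of structure along an injection \<open>e\<close> into the natural numbers:
  decode with \<open>d\<close>, multiply, encode again. This moves a group of series to the carrier
  type \<open>nat\<close>.\<close>

lemma (in ordered_group) nat_copy:
  assumes "countable (carrier G)"
  obtains K :: "nat monoid" and r' h where "ordered_group K r'" "h \<in> iso G K"
proof -
  define e where "e = to_nat_on (carrier G)"
  define d where "d = inv_into (carrier G) e"
  have inj: "inj_on e (carrier G)"
    using assms by (simp add: e_def inj_on_to_nat_on)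
  then have d [simp]: "d (e x) = x" if "x \<in> carrier G" for x
    using that by (simp add: d_def)
  define K :: "nat monoid" where
    "K = \<lparr>carrier = e ` carrier G, monoid.mult = \<lambda>x y. e (d x \<otimes> d y), one = e \<one>\<rparr>"
  define r' where "r' = map_prod e e ` r"
  have r: "r \<subseteq> carrier G \<times> carrier G"
    using linear_order by (simp add: linear_order_on_def partial_order_on_def preorder_on_def)
  have r': "(e x, e y) \<in> r' \<longleftrightarrow> (x, y) \<in> r" if "x \<in> carrier G" "y \<in> carrier G" for x y
  proof
    assume "(e x, e y) \<in> r'"
    then obtain a b where "(a, b) \<in> r" "e x = e a" "e y = e b"
      by (auto simp: r'_def)
    then show "(x, y) \<in> r"
      using r that inj_onD[OF inj] by (metis SigmaD1 SigmaD2 subsetD)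
  qed (auto simp: r'_def)
  have "group K"
  proof (rule groupI)
    fix x assume "x \<in> carrier K"
    then obtain y where "x = e y" "y \<in> carrier G"
      by (auto simp: K_def)
    then show "\<exists>z\<in>carrier K. z \<otimes>\<^bsub>K\<^esub> x = \<one>\<^bsub>K\<^esub>"
      by (intro bexI[of _ "e (inv y)"]) (auto simp: K_def)
  qed (auto simp: K_def m_assoc)
  moreover have "linear_order_on (carrier K) r'"
    unfolding linear_order_on_def partial_order_on_def preorder_on_def
  proof (intro conjI)
    note lin = linear_order[unfolded linear_order_on_def partial_order_on_def preorder_on_def]
    show sub: "r' \<subseteq> carrier K \<times> carrier K"
      using r by (auto simp: r'_def K_def)
    show "refl_on (carrier K) r'"
      using lin by (auto simp: refl_on_def K_def r')
    show "trans r'"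
    proof (rule transI)
      fix x y z assume *: "(x, y) \<in> r'" "(y, z) \<in> r'"
      then have "x \<in> e ` carrier G" "y \<in> e ` carrier G" "z \<in> e ` carrier G"
        using sub by (auto simp: K_def)
      then obtain a b c where "x = e a" "y = e b" "z = e c" "a \<in> carrier G" "b \<in> carrier G" "c \<in> carrier G"
        by blast
      then show "(x, z) \<in> r'"
        using * lin by (auto simp: r' dest: transD)
    qed
    show "antisym r'"
    proof (rule antisymI)
      fix x y assume *: "(x, y) \<in> r'" "(y, x) \<in> r'"
      then have "x \<in> e ` carrier G" "y \<in> e ` carrier G"
        using sub by (auto simp: K_def)
      then obtain a b where "x = e a" "y = e b" "a \<in> carrier G" "b \<in> carrier G"
        by blast
      then show "x = y"
        using * lin by (auto simp: r' dest: antisymD)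
    qed
    show "total_on (carrier K) r'"
      using lin by (auto simp: total_on_def K_def r')
  qed
  ultimately have "ordered_group K r'"
  proof (intro ordered_group.intro ordered_group_axioms.intro)
    fix x y a b
    assume "x \<in> carrier K" "y \<in> carrier K" "a \<in> carrier K" "b \<in> carrier K" and "(a, b) \<in> r'"
    then show "(x \<otimes>\<^bsub>K\<^esub> a \<otimes>\<^bsub>K\<^esub> y, x \<otimes>\<^bsub>K\<^esub> b \<otimes>\<^bsub>K\<^esub> y) \<in> r'"
      using mult_mono by (auto simp: K_def r')
  qed
  moreover have "e \<in> iso G K"
    using inj by (auto simp: iso_def hom_def bij_betw_def K_def)
  ultimately show ?thesis
    using that by blast
qed

lemma (in group_hom) set_mult_image:
  assumes "S \<subseteq> carrier G" "T \<subseteq> carrier G"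
  shows "h ` (S <#> T) = h ` S <#>\<^bsub>H\<^esub> h ` T"
proof -
  have "h (s \<otimes> t) = h s \<otimes>\<^bsub>H\<^esub> h t" if "s \<in> S" "t \<in> T" for s t
    using that assms by (simp add: subset_iff)
  then show ?thesis
    by (force simp: set_mult_def)
qed

section \<open>The group generated by two Magnus generators\<close>

theorem theorem2p11:
  shows "\<exists>(G :: nat monoid) (r :: (nat \<times> nat) set).
    ordered_group G r \<and> \<not> solvable G \<and>
    (\<forall>k::nat. k \<ge> 3 \<longrightarrow>
      (\<exists>S. S \<subseteq> carrier G \<and> card S = k \<and>
           card (S <#>\<^bsub>G\<^esub> S) = 4 * card S - 5 \<and>
           generate G S = carrier G \<and>
           \<not> solvable (G \<lparr> carrier := generate G S \<rparr>)))"
proof -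
  define M :: "(nat, int) ncseries monoid" where "M = magnus_group"
  interpret M: ordered_group M magnus_order
    unfolding M_def by (rule ordered_group_magnus_group)
  obtain x y :: nat where xy: "x \<noteq> y"
    using zero_neq_one by blast
  define b c :: "(nat, int) ncseries" where "b = 1 + nc_var y" "c = 1 + nc_var x"
  have bc: "b \<in> carrier M" "c \<in> carrier M"
    unfolding b_c_def M_def by (rule one_plus_nc_var_in_magnus_group)+
  \<comment> \<open>Two generators make \<open>H\<close> countable, hence transportable to
    \<open>nat\<close>, and one \<open>H\<close> serves all \<open>k\<close>: every set
    \<open>S\<close> used below lies in \<open>H\<close> and contains \<open>b\<close> and
    \<open>c\<close>.\<close>
  define H where "H = generate M {b, c}"
  have H: "subgroup H M"
    unfolding H_def using bc by (intro M.generate_is_subgroup) auto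
  let ?HM = "M\<lparr>carrier := H\<rparr>"
  have "noncommuting_leads H"
    unfolding noncommuting_leads_def
  proof (intro bexI exI conjI)
    show "leading_word (b - 1) [y]" "leading_word (c - 1) [x]"
      by (simp_all add: b_c_def leading_word_nc_var)
    show "b \<in> H" "c \<in> H"
      by (simp_all add: H_def generate.incl)
  qed (use xy in simp)
  then have not_solvable: "\<not> solvable ?HM"
    using H unfolding M_def by (intro noncommuting_leads_imp_not_solvable)
  interpret HM: ordered_group ?HM "Restr magnus_order H"
    using H by (rule M.ordered_subgroup)
  have "countable (carrier ?HM)"
    using bc by (auto simp: H_def intro!: M.countable_generate)
  then obtain K :: "nat monoid" and r h where K: "ordered_group K r" and h: "h \<in> iso ?HM K"
    by (rule HM.nat_copy)
  interpret K: ordered_group K r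
    by (rule K)
  interpret h: group_hom ?HM K h
    using h by unfold_locales (simp add: iso_def)
  have inj: "inj_on h H" and surj: "h ` H = carrier K"
    using h by (simp_all add: iso_def bij_betw_def)
  have not_solvable_K: "\<not> solvable K"
    using h.inj_hom_imp_solvable not_solvable inj by auto
  have "\<exists>S. S \<subseteq> carrier K \<and> card S = k \<and> card (S <#>\<^bsub>K\<^esub> S) = 4 * card S - 5 \<and>
      generate K S = carrier K \<and> \<not> solvable (K\<lparr>carrier := generate K S\<rparr>)" if k: "3 \<le> k" for k
  proof -
    note coeffs = nc_coeff_one_plus_var_power[OF xy] nc_coeff_mult_singleton
      nc_coeff_mult_pair nc_coeff_one nc_coeff_var
    obtain S where S: "S \<subseteq> H" "{b, c} \<subseteq> S" "card S = k" "card (S <#>\<^bsub>M\<^esub> S) = 4 * card S - 5"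
      unfolding H_def
    proof (rule M.small_doubling_set[OF bc _ _ _ _ _ k])
      have pow: "f [^]\<^bsub>M\<^esub> i = f ^ i" "f \<otimes>\<^bsub>M\<^esub> g = f * g" for i :: nat and f g
        by (simp_all add: M_def nat_pow_magnus_group)
      \<comment> \<open>Each relation is refuted by one coefficient. At \<open>[x]\<close>,
        \<open>c^i\<close> has \<open>i\<close>. At \<open>[x, y]\<close>, \<open>b c^i\<close> has
        0 while \<open>c^j b\<close> has \<open>j\<close>. At \<open>[y]\<close>, powers of
        \<open>c\<close> have 0, whereas \<open>b c^i\<close> and \<open>c^i b\<close> have 1 and
        \<open>b^2\<close> has 2.\<close>
      fix i j :: nat
      show "i = j" if "c [^]\<^bsub>M\<^esub> i = c [^]\<^bsub>M\<^esub> j"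
        using arg_cong[OF that, of "\<lambda>f. nc_coeff f [x]"] xy by (simp add: pow b_c_def coeffs)
      show "j = 0" if "b \<otimes>\<^bsub>M\<^esub> c [^]\<^bsub>M\<^esub> i = c [^]\<^bsub>M\<^esub> j \<otimes>\<^bsub>M\<^esub> b"
        using arg_cong[OF that, of "\<lambda>f. nc_coeff f [x, y]"] xy by (simp add: pow b_c_def coeffs)
      show "b \<otimes>\<^bsub>M\<^esub> c [^]\<^bsub>M\<^esub> i \<noteq> c [^]\<^bsub>M\<^esub> j"
        by (rule notI, drule arg_cong[of _ _ "\<lambda>f. nc_coeff f [y]"]) (use xy in \<open>simp add: pow b_c_def coeffs\<close>)
      show "c [^]\<^bsub>M\<^esub> i \<otimes>\<^bsub>M\<^esub> b \<noteq> c [^]\<^bsub>M\<^esub> j"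
        by (rule notI, drule arg_cong[of _ _ "\<lambda>f. nc_coeff f [y]"]) (use xy in \<open>simp add: pow b_c_def coeffs\<close>)
      show "b \<otimes>\<^bsub>M\<^esub> b \<noteq> c [^]\<^bsub>M\<^esub> i"
        by (rule notI, drule arg_cong[of _ _ "\<lambda>f. nc_coeff f [y]"]) (use xy in \<open>simp add: pow b_c_def coeffs\<close>)
    qed
    have "generate M S = H"
      using S bc M.generate_subgroup_incl[OF S(1) H] M.mono_generate[OF S(2)] by (auto simp: H_def)
    then have gen: "generate ?HM S = H"
      using M.generate_consistent[OF S(1) H] by simp
    have SS: "S <#>\<^bsub>M\<^esub> S \<subseteq> H"
      using S(1) subgroup.m_closed[OF H] by (auto simp: set_mult_def)
    have "S <#>\<^bsub>?HM\<^esub> S = S <#>\<^bsub>M\<^esub> S"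
      by (simp add: set_mult_def)
    then have "h ` S <#>\<^bsub>K\<^esub> h ` S = h ` (S <#>\<^bsub>M\<^esub> S)"
      using h.set_mult_image[of S S] S(1) by simp
    then have "card (h ` S <#>\<^bsub>K\<^esub> h ` S) = 4 * card S - 5"
      using S(4) card_image[OF inj_on_subset[OF inj SS]] by simp
    moreover have "card (h ` S) = card S"
      using card_image[OF inj_on_subset[OF inj S(1)]] .
    moreover have "generate K (h ` S) = carrier K"
      using h.generate_img[of S] gen S(1) surj by simp
    \<comment> \<open>Since \<open>h\<close> maps \<open>S\<close> to a generating set of
      \<open>K\<close>, the last conjunct is the non-solvability of \<open>K\<close> itself.\<close>
    ultimately show ?thesis
      using S(1,3) surj not_solvable_K by (intro exI[of _ "h ` S"]) auto
  qed
  then show ?thesis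
    using K not_solvable_K by blast
qed

end
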